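(* Let $d\geq 2$ be even and let $G$ be a simple graph of order $n\geq 2$ (not necessarily connected). Then: (a) $\|G\|_d\leq\tfrac12\|G\|_*$, and equality is attained by the graph of order $n$ with exactly one edge. (b) $\dfrac{\|K_n\|_d}{n-1}\,\|G\|\leq\|G\|_d\leq\dbinom{\lfloor\frac{n+d}{2}\rfloor-1}{\frac d2}\|G\|$, where equality in the lower bound is attained by the complete graph $K_n$, and equality in the upper bound is attained by the graph with $\lfloor n/2\rfloor$ edges in which no vertex has degree greater than $1$.
   Context: For a simple graph $G$ of order $n$, $A(G)$ is its adjacency matrix, with real eigenvalues $\lambda_1\geq\cdots\geq\lambda_n$ and singular values $\sigma_1\geq\cdots\geq\sigma_n$ (the absolute values of the eigenvalues). The energy of $G$ is $\|G\|_*=\sigma_1+\cdots+\sigma_n$ and the spectral norm is $\|G\|=\sigma_1$. The CHS polynomial of degree $d$ is $h_d(x_1,\dots,x_n)=\sum_{1\leq i_1\leq\cdots\leq i_d\leq n}x_{i_1}\cdots x_{i_d}$, and for even $d\geq 2$, $\|G\|_d=(h_d(\lambda_1,\dots,\lambda_n))^{1/d}$. $K_n$ denotes the complete graph on $n$ vertices and $\lfloor x\rfloor$ the floor of $x$.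
   Formalization: In the upper bound of (b) the binomial coefficient is raised to the power 1/d; as printed, without this exponent, the equality claim fails (n=4, d=2: two disjoint edges give √2, not 2), and the corrected bound implies the printed inequality. *)

theory Defs
  imports "Jordan_Normal_Form.Char_Poly"
begin

type_synonym 'a ugraph = "'a set \<times> 'a set set"

abbreviation vertices :: "'a ugraph \<Rightarrow> 'a set" where "vertices \<equiv> fst"

abbreviation edges :: "'a ugraph \<Rightarrow> 'a set set" where "edges \<equiv> snd"

definition simple_graph :: "'a ugraph \<Rightarrow> bool" where
  "simple_graph G \<longleftrightarrow> finite (vertices G) \<and> (\<forall>e\<in>edges G. e \<subseteq> vertices G \<and> card e = 2)"

definition graph_order :: "'a ugraph \<Rightarrow> nat" where
  "graph_order G = card (vertices G)"

definition vertex_degree :: "'a ugraph \<Rightarrow> 'a \<Rightarrow> nat" where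
  "vertex_degree G v = card {e \<in> edges G. v \<in> e}"

definition complete_graph :: "nat \<Rightarrow> nat ugraph" where
  "complete_graph n = ({..<n}, {e. e \<subseteq> {..<n} \<and> card e = 2})"

definition adj_mat_of :: "'a list \<Rightarrow> 'a set set \<Rightarrow> real mat" where
  "adj_mat_of vs E =
     mat (length vs) (length vs) (\<lambda>(i, j). if {vs ! i, vs ! j} \<in> E then 1 else 0)"

text \<open>The vertices are enumerated in an arbitrary order; by
  \<open>char_poly_adj_mat_of_cong\<close> below the characteristic polynomial, and hence everything
  derived from the eigenvalues, does not depend on the choice.\<close>

definition adjacency_matrix :: "'a ugraph \<Rightarrow> real mat" where
  "adjacency_matrix G =
     adj_mat_of (SOME vs. distinct vs \<and> set vs = vertices G) (edges G)"

text \<open>The list \<open>\<lambda>\<^sub>1 \<ge> \<dots> \<ge> \<lambda>\<^sub>n\<close>, with algebraic multiplicities. Only real roots of the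
  characteristic polynomial are collected, which are all of them since the matrix is
  symmetric.\<close>

definition graph_eigenvalues :: "'a ugraph \<Rightarrow> real list" where
  "graph_eigenvalues G =
     rev (sorted_list_of_multiset (proots (char_poly (adjacency_matrix G))))"

definition graph_singular_values :: "'a ugraph \<Rightarrow> real list" where
  "graph_singular_values G = rev (sort (map abs (graph_eigenvalues G)))"

definition graph_energy :: "'a ugraph \<Rightarrow> real" where
  "graph_energy G = sum_list (graph_singular_values G)"

definition spectral_norm :: "'a ugraph \<Rightarrow> real" where
  "spectral_norm G = hd (graph_singular_values G)"

definition chs_poly :: "nat \<Rightarrow> real list \<Rightarrow> real" where
  "chs_poly d xs =
     (\<Sum>js\<in>{js. length js = d \<and> sorted js \<and> set js \<subseteq> {..<length xs}}. \<Prod>j\<leftarrow>js. xs ! j)"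

definition chs_norm :: "nat \<Rightarrow> 'a ugraph \<Rightarrow> real" where
  "chs_norm d G = root d (chs_poly d (graph_eigenvalues G))"

lemma char_poly_adj_mat_of_cong:
  assumes "distinct vs" "distinct ws" "set vs = set ws"
  shows "char_poly (adj_mat_of vs E) = char_poly (adj_mat_of ws E)"
proof -
  define n where "n = length vs"
  have lw: "length ws = n"
    unfolding n_def using assms by (metis distinct_card)
  have "\<forall>i<n. \<exists>j<n. ws ! j = vs ! i"
    using assms lw unfolding n_def by (metis in_set_conv_nth nth_mem)
  then obtain p where p: "\<And>i. i < n \<Longrightarrow> p i < n \<and> ws ! p i = vs ! i"
    by metis
  have inj: "inj_on p {..<n}"
    using p assms(1) unfolding inj_on_def n_def by (metis lessThan_iff nth_eq_iff_index_eq)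
  have surj: "p ` {..<n} = {..<n}"
    by (rule endo_inj_surj) (use p inj in auto)
  define P :: "real mat" where "P = mat n n (\<lambda>(i, k). if k = p i then 1 else 0)"
  define Q :: "real mat" where "Q = mat n n (\<lambda>(k, j). if k = p j then 1 else 0)"
  define B where "B = adj_mat_of ws E"
  have car: "P \<in> carrier_mat n n" "Q \<in> carrier_mat n n" "B \<in> carrier_mat n n"
    "adj_mat_of vs E \<in> carrier_mat n n"
    by (auto simp: P_def Q_def B_def adj_mat_of_def n_def lw[unfolded n_def])
  have PQ: "P * Q = 1\<^sub>m n"
  proof (rule eq_matI)
    fix i j assume "i < dim_row (1\<^sub>m n :: real mat)" "j < dim_col (1\<^sub>m n :: real mat)"
    then have ij: "i < n" "j < n" by auto
    have "(P * Q) $$ (i, j) = (\<Sum>k\<in>{0..<n}. (if k = p i then 1 else 0) * (if k = p j then 1 else 0))"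
      using ij by (simp add: P_def Q_def scalar_prod_def)
    also have "\<dots> = (\<Sum>k\<in>{0..<n}. if k = p i then (if p i = p j then 1 else 0) else 0)"
      by (rule sum.cong) auto
    also have "\<dots> = (if p i = p j then 1 else 0)"
      using p[OF ij(1)] by simp
    also have "\<dots> = 1\<^sub>m n $$ (i, j)"
      using ij inj by (auto simp: inj_on_def)
    finally show "(P * Q) $$ (i, j) = 1\<^sub>m n $$ (i, j)" .
  qed (auto simp: P_def Q_def)
  then have QP: "Q * P = 1\<^sub>m n"
    using mat_mult_left_right_inverse[OF car(1,2)] by simp
  have "adj_mat_of vs E = P * B * Q"
  proof (rule eq_matI)
    fix i j assume "i < dim_row (P * B * Q)" "j < dim_col (P * B * Q)"
    then have ij: "i < n" "j < n" by (auto simp: P_def Q_def)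
    have PB: "(P * B) $$ (i, k) = B $$ (p i, k)" if "k < n" for k
    proof -
      have "(P * B) $$ (i, k) = (\<Sum>l\<in>{0..<n}. (if l = p i then 1 else 0) * B $$ (l, k))"
        using ij that car by (simp add: P_def scalar_prod_def)
      also have "\<dots> = (\<Sum>l\<in>{0..<n}. if l = p i then B $$ (p i, k) else 0)"
        by (rule sum.cong) auto
      finally show ?thesis using p[OF ij(1)] by simp
    qed
    have "(P * B * Q) $$ (i, j) = (\<Sum>k\<in>{0..<n}. (P * B) $$ (i, k) * Q $$ (k, j))"
      using ij car by (simp add: scalar_prod_def del: assoc_mult_mat)
    also have "\<dots> = (\<Sum>k\<in>{0..<n}. if k = p j then B $$ (p i, p j) else 0)"
      using ij by (intro sum.cong) (auto simp: PB Q_def)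
    also have "\<dots> = B $$ (p i, p j)" using p[OF ij(2)] by simp
    also have "\<dots> = adj_mat_of vs E $$ (i, j)"
      using p[OF ij(1)] p[OF ij(2)] ij by (simp add: B_def adj_mat_of_def lw n_def[symmetric])
    finally show "adj_mat_of vs E $$ (i, j) = (P * B * Q) $$ (i, j)" ..
  qed (use car in auto)
  then have "similar_mat (adj_mat_of vs E) B"
    using car PQ QP by (intro similar_matI[of _ _ P Q n]) auto
  then show ?thesis unfolding B_def by (rule char_poly_similar)
qed

end

theory Submission
  imports
    Defs
    "HOL-Computational_Algebra.Formal_Power_Series"
    "Jordan_Normal_Form.Schur_Decomposition"
begin

text \<open>
  If \<open>x + y = x' + y'\<close>, then, up to the factor \<open>x' y' - x y\<close>, the difference of \<open>h\<^sub>d\<^sub>+\<^sub>2\<close> at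
  \<open>(x, y, \<dots>)\<close> and at \<open>(x', y', \<dots>)\<close> is \<open>h\<^sub>d\<close> at \<open>(x, y, x', y', \<dots>)\<close>. By induction on the even
  degree this yields both Hunter's theorem \<open>h\<^sub>d \<ge> 0\<close> and the fact that \<open>h\<^sub>d\<close> increases when two
  arguments are moved apart with their sum fixed. All bounds then concern a list of
  reals with sum \<open>0\<close> (the trace): merging arguments of equal sign leads to
  \<open>(s, -s, 0, \<dots>)\<close> with \<open>s\<close> half the energy; pushing arguments to the ends of \<open>[-s, s]\<close> leads
  to equally many \<open>s\<close> and \<open>-s\<close>; averaging all arguments but one leads to a multiple of the
  spectrum of \<open>K\<^sub>n\<close>. Since \<open>h\<^sub>d\<close> is even, the kept argument may be any eigenvalue of largest
  modulus, and no Perron-Frobenius theory is needed. The eigenvalues of \<open>K\<^sub>n\<close> and of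
  matchings lie in \<open>{n - 1, -1}\<close> and \<open>{1, 0, -1}\<close>; the traces of \<open>A\<close> and \<open>A\<^sup>2\<close> determine their
  multiplicities.
\<close>

subsection \<open>Complete homogeneous symmetric polynomials of a multiset\<close>

text \<open>Each factor is a geometric series, so the coefficients are the polynomials
  \<open>h_d\<close>. Taking the arguments as a multiset makes their symmetry automatic.\<close>

definition chs_gf :: "real multiset \<Rightarrow> real fps" where
  "chs_gf M = (\<Prod>x\<in>#M. inverse (1 - fps_const x * fps_X))"

definition chs :: "nat \<Rightarrow> real multiset \<Rightarrow> real" where
  "chs d M = fps_nth (chs_gf M) d"

lemma chs_gf_add_mset: "chs_gf (add_mset x M) * (1 - fps_const x * fps_X) = chs_gf M"
proof -
  have "inverse (1 - fps_const x * fps_X) * (1 - fps_const x * fps_X) = 1"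
    by (rule inverse_mult_eq_1) simp
  then show ?thesis
    by (simp add: chs_gf_def ac_simps)
qed

lemma chs_empty [simp]: "chs d {#} = 0 ^ d"
  by (cases d) (simp_all add: chs_def chs_gf_def)

lemma chs_0 [simp]: "chs 0 M = 1"
proof (induction M)
  case (add x M)
  then show ?case
    using arg_cong[OF chs_gf_add_mset[of x M], of "\<lambda>f. fps_nth f 0"]
    by (simp add: chs_def fps_mult_nth)
qed simp

text \<open>Coefficients in \<open>chs_gf_add_mset\<close> are compared. In terms of monomials:
  either one factor \<open>x\<close> is split off, and \<open>x\<close> may occur again, or
  \<open>x\<close> does not occur at all.\<close>

lemma chs_Suc: "chs (Suc d) (add_mset x M) = x * chs d (add_mset x M) + chs (Suc d) M"
proof -
  have "chs_gf M = chs_gf (add_mset x M) - fps_const x * (fps_X * chs_gf (add_mset x M))"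
    using chs_gf_add_mset[of x M] by (simp add: algebra_simps)
  then have "fps_nth (chs_gf M) (Suc d) = 
     fps_nth (chs_gf (add_mset x M) - fps_const x * (fps_X * chs_gf (add_mset x M))) (Suc d)"
    by (rule arg_cong)
  then show ?thesis
    by (simp add: chs_def)
qed

lemma chs_zero [simp]: "chs d (add_mset 0 M) = chs d M"
  by (cases d) (simp_all add: chs_Suc)

lemma chs_zeros [simp]: "chs d (M + replicate_mset k 0) = chs d M"
  by (induction k) simp_all

lemma chs_nonneg_of_nonneg:
  assumes "\<And>x. x \<in># M \<Longrightarrow> x \<ge> 0"
  shows "chs d M \<ge> 0"
  using assms
proof (induction M arbitrary: d)
  case (add x M)
  show ?case
  proof (induction d)
    case (Suc d)
    then show ?case
      using add.IH[of "Suc d"] add.prems by (simp add: chs_Suc)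
  qed simp
qed simp

lemma chs_scale: "chs d (image_mset (\<lambda>x. c * x) M) = c ^ d * chs d M"
proof (induction M arbitrary: d)
  case empty
  then show ?case by (cases d) simp_all
next
  case (add x M)
  show ?case
  proof (induction d)
    case (Suc d)
    then show ?case
      using add.IH[of "Suc d"] by (simp add: chs_Suc algebra_simps)
  qed simp
qed

text \<open>The pair contributes the factor \<open>1 / (1 - x^2 X^2)\<close> to the generating
  function, so the degree drops in steps of two.\<close>

lemma chs_pair:
  "chs (Suc (Suc d)) (add_mset x (add_mset (- x) M)) =
     x\<^sup>2 * chs d (add_mset x (add_mset (- x) M)) + chs (Suc (Suc d)) M"
  by (simp add: chs_Suc algebra_simps power2_eq_square)

text \<open>With \<open>P = (1 - x X) (1 - y X)\<close> and \<open>P' = (1 - x' X) (1 - y' X)\<close>, the two generating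
  functions are \<open>K P'\<close> and \<open>K P\<close> where \<open>K\<close> is that of the multiset on the right, and
  \<open>P' - P = (x' y' - x y) X\<^sup>2\<close>.\<close>

lemma chs_transfer:
  assumes "x + y = x' + y'"
  shows "chs (Suc (Suc d)) (add_mset x (add_mset y M)) -
           chs (Suc (Suc d)) (add_mset x' (add_mset y' M)) =
         (x' * y' - x * y) * chs d (add_mset x (add_mset y (add_mset x' (add_mset y' M))))"
proof -
  define L where "L = (\<lambda>x::real. 1 - fps_const x * fps_X)"
  define K where "K = chs_gf (add_mset x (add_mset y (add_mset x' (add_mset y' M))))"
  have K1: "chs_gf (add_mset x' (add_mset y' M)) = K * (L x * L y)"
    unfolding K_def L_def
    by (metis (no_types, lifting) chs_gf_add_mset mult.assoc)
  \<comment> \<open>The two pairs change places, so that now \<open>x'\<close> and \<open>y'\<close>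
    are the outer entries and can be cancelled.\<close>
  have K': "K = chs_gf (add_mset x' (add_mset y' (add_mset x (add_mset y M))))"
    unfolding K_def by (simp add: add_mset_commute)
  have K2: "chs_gf (add_mset x (add_mset y M)) = K * (L x' * L y')"
    unfolding K' L_def
    by (metis (no_types, lifting) chs_gf_add_mset mult.assoc)
  have LL: "L a * L b = 1 - fps_const (a + b) * fps_X + fps_const (a * b) * fps_X ^ 2" for a b
    by (simp add: L_def algebra_simps power2_eq_square flip: fps_const_add fps_const_mult)
  have "chs_gf (add_mset x (add_mset y M)) - chs_gf (add_mset x' (add_mset y' M)) =
          K * (L x' * L y' - L x * L y)"
    unfolding K1 K2 by (simp add: algebra_simps)
  also have "\<dots> = fps_const (x' * y' - x * y) * (fps_X ^ 2 * K)"
    unfolding LL assms by (simp add: algebra_simps flip: fps_const_sub)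
  finally have "fps_nth (chs_gf (add_mset x (add_mset y M)) - chs_gf (add_mset x' (add_mset y' M))) (Suc (Suc d))
      = fps_nth (fps_const (x' * y' - x * y) * (fps_X ^ 2 * K)) (Suc (Suc d))"
    by (rule arg_cong)
  then show ?thesis
    by (simp add: chs_def K_def fps_X_power_mult_nth)
qed

section \<open>Averaging and Hunter's theorem\<close>

lemma sum_mset_strict_mono:
  fixes f g :: "'a \<Rightarrow> 'b :: ordered_cancel_comm_monoid_add"
  assumes "M \<noteq> {#}" "\<And>x. x \<in># M \<Longrightarrow> f x < g x"
  shows "(\<Sum>x\<in>#M. f x) < (\<Sum>x\<in>#M. g x)"
proof -
  obtain x N where "M = add_mset x N" using assms(1) by (meson multi_nonempty_split)
  moreover from this have "(\<Sum>x\<in>#N. f x) \<le> (\<Sum>x\<in>#N. g x)"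
    using assms(2) by (intro sum_mset_mono) (simp add: less_imp_le)
  ultimately show ?thesis using assms(2) by (simp add: add_less_le_mono)
qed

text \<open>Positivity in degree \<open>d\<close> is a hypothesis because Hunter's theorem is
  deduced from this lemma by induction. An entry \<open>x\<close> below the mean and an entry
  \<open>y\<close> above it are replaced by \<open>a\<close> and \<open>x + y - a\<close>; by
  \<open>chs_transfer\<close> the value falls by \<open>(a - x) * (y - a)\<close> times a value in
  degree \<open>d\<close>. \<open>R\<close> collects the entries that are already settled.\<close>

lemma chs_average_le_aux:
  fixes a :: real
  assumes pos: "\<And>M. chs d M \<ge> 0"
    and "sum_mset M = real (size M) * a"
  shows "chs (Suc (Suc d)) (R + replicate_mset (size M) a) \<le> chs (Suc (Suc d)) (R + M)"
  using assms(2)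
proof (induction "size M" arbitrary: M R)
  case 0
  then show ?case by simp
next
  case (Suc n)
  show ?case
  proof (cases "a \<in># M")
    case True
    then obtain M' where M: "M = add_mset a M'" by (metis insert_DiffM)
    have "chs (Suc (Suc d)) (add_mset a R + replicate_mset (size M') a)
           \<le> chs (Suc (Suc d)) (add_mset a R + M')"
      using Suc.hyps(2) Suc.prems by (intro Suc.hyps(1)) (auto simp: M algebra_simps)
    then show ?thesis by (simp add: M)
  next
    case False
    have "M \<noteq> {#}" using Suc.hyps(2) by auto
    \<comment> \<open>As \<open>a\<close> itself does not occur, entries all on one side of it would
      be strictly on that side, and their mean could not be \<open>a\<close>.\<close>
    have "\<exists>x\<in>#M. x < a"
    proof (rule ccontr)
      assume "\<not> ?thesis"
      then have "\<And>x. x \<in># M \<Longrightarrow> a < x" using False by (metis linorder_neqE_linordered_idom)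
      then have "(\<Sum>x\<in>#M. a) < (\<Sum>x\<in>#M. x)"
        using \<open>M \<noteq> {#}\<close> by (intro sum_mset_strict_mono)
      then show False using Suc.prems by simp
    qed
    then obtain x where x: "x \<in># M" "x < a" by blast
    then obtain M1 where M1: "M = add_mset x M1" by (metis insert_DiffM)
    have "\<exists>y\<in>#M. y > a"
    proof (rule ccontr)
      assume "\<not> ?thesis"
      then have "\<And>x. x \<in># M \<Longrightarrow> x < a" using False by (metis linorder_neqE_linordered_idom)
      then have "(\<Sum>x\<in>#M. x) < (\<Sum>x\<in>#M. a)"
        using \<open>M \<noteq> {#}\<close> by (intro sum_mset_strict_mono)
      then show False using Suc.prems by simp
    qed
    then obtain y where y: "y \<in># M1" "a < y" using x M1 by auto
    then obtain M' where M': "M = add_mset x (add_mset y M')" 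
      using M1 by (metis insert_DiffM)
    \<comment> \<open>What remains to be averaged once \<open>a\<close> has been split off; its mean
      is still \<open>a\<close>.\<close>
    define N where "N = add_mset (x + y - a) M'"
    have "chs (Suc (Suc d)) (R + replicate_mset (size M) a) =
          chs (Suc (Suc d)) (add_mset a R + replicate_mset (size N) a)"
      by (simp add: N_def M')
    also have "\<dots> \<le> chs (Suc (Suc d)) (add_mset a R + N)"
      using Suc.hyps(2) Suc.prems by (intro Suc.hyps(1)) (auto simp: M' N_def algebra_simps)
    also have "\<dots> = chs (Suc (Suc d)) (add_mset a (add_mset (x + y - a) (R + M')))"
      by (simp add: N_def add_mset_commute)
    also have "\<dots> \<le> chs (Suc (Suc d)) (add_mset x (add_mset y (R + M')))"
    proof -
      have "(a * (x + y - a) - x * y) = (a - x) * (y - a)" by (simp add: algebra_simps)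
      also have "\<dots> \<ge> 0" using x y by simp
      finally show ?thesis
        using chs_transfer[of x y a "x + y - a" d "R + M'"] 
          pos[of "add_mset x (add_mset y (add_mset a (add_mset (x + y - a) (R + M'))))"]
        by (smt (verit) mult_nonneg_nonneg)
    qed
    finally show ?thesis by (simp add: M')
  qed
qed

text \<open>Replacing all entries by their mean \<open>a\<close> does not increase the value in
  degree \<open>d + 2\<close>, given positivity in degree \<open>d\<close>. The constant multiset
  then gives \<open>a ^ (d + 2)\<close>, an even power, times a value at ones.\<close>

lemma chs_nonneg:
  assumes "even d"
  shows "chs d M \<ge> 0"
  using assms
proof (induction d arbitrary: M rule: nat_induct2)
  case (step d)
  define t where "t = sum_mset M"
  \<comment> \<open>For empty \<open>M\<close> the quotient is 0 by convention, and the next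
    equation reads 0 = 0.\<close>
  define a where "a = t / real (size M)"
  have t: "t = real (size M) * a" by (cases "M = {#}") (simp add: t_def, simp add: a_def)
  have "0 \<le> a ^ Suc (Suc d) * chs (Suc (Suc d)) (replicate_mset (size M) 1)"
    using step.prems by (intro mult_nonneg_nonneg chs_nonneg_of_nonneg zero_le_even_power)
      (auto split: if_splits)
  also have "\<dots> = chs (Suc (Suc d)) ({#} + replicate_mset (size M) a)"
    by (subst chs_scale[symmetric]) simp
  also have "\<dots> \<le> chs (Suc (Suc d)) ({#} + M)"
    using step t by (intro chs_average_le_aux) (auto simp: t_def)
  finally show ?case by simp
qed simp_all

text \<open>By \<open>chs_transfer\<close> and Hunter's theorem the comparison depends only on the
  sign of \<open>x' * y' - x * y\<close>. For a fixed sum, a smaller product means arguments further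
  apart.\<close>

lemma chs_spread_le:
  assumes "even d" "x + y = x' + y'" "x' * y' \<le> x * y"
  shows "chs d (add_mset x (add_mset y M)) \<le> chs d (add_mset x' (add_mset y' M))"
proof (cases "d = 0")
  case False
  then obtain e where e: "d = Suc (Suc e)" "even e"
    using assms(1) by (metis even_Suc dvd_0_right old.nat.exhaust)
  have "(x' * y' - x * y) * chs e (add_mset x (add_mset y (add_mset x' (add_mset y' M)))) \<le> 0"
    using assms(3) chs_nonneg[OF e(2)] by (simp add: mult_nonpos_nonneg)
  then show ?thesis
    using chs_transfer[OF assms(2), of e M] e(1) by simp
qed simp

lemma chs_average_le:
  assumes "even d" "sum_mset M = real (size M) * a"
  shows "chs d (R + replicate_mset (size M) a) \<le> chs d (R + M)"
proof (cases "d = 0")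
  case False
  then obtain e where "d = Suc (Suc e)" "even e"
    using assms(1) by (metis even_Suc dvd_0_right old.nat.exhaust)
  then show ?thesis
    using chs_average_le_aux[of e M a R] chs_nonneg assms(2) by simp
qed simp

text \<open>Two entries of equal sign have a nonnegative product, so passing to their sum and 0
  moves them apart. The 0 then drops out.\<close>

lemma chs_merge_le:
  assumes "even d" "(\<forall>x\<in>#P. x \<ge> 0) \<or> (\<forall>x\<in>#P. x \<le> 0)"
  shows "chs d (R + P) \<le> chs d (add_mset (sum_mset P) R)"
  using assms(2)
proof (induction P arbitrary: R)
  case (add x P)
  have "chs d (R + add_mset x P) = chs d (add_mset x R + P)" by simp
  also have "\<dots> \<le> chs d (add_mset (sum_mset P) (add_mset x R))"
    using add.prems by (intro add.IH) auto
  also have "\<dots> \<le> chs d (add_mset (x + sum_mset P) (add_mset 0 R))"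
  proof (rule chs_spread_le[OF assms(1)])
    from add.prems show "(x + sum_mset P) * 0 \<le> sum_mset P * x"
    proof
      assume *: "\<forall>x\<in>#add_mset x P. 0 \<le> x"
      then have "(\<Sum>x\<in>#P. 0) \<le> sum_mset P"
        using sum_mset_mono[of P "\<lambda>x. 0" "\<lambda>x. x"] by simp
      then show ?thesis using * by simp
    next
      assume *: "\<forall>x\<in>#add_mset x P. x \<le> 0"
      then have "sum_mset P \<le> (\<Sum>x\<in>#P. 0)"
        using sum_mset_mono[of P "\<lambda>x. x" "\<lambda>x. 0"] by simp
      then show ?thesis using * by (simp add: mult_nonpos_nonpos)
    qed
  qed simp
  finally show ?case by (simp add: add_mset_commute[of _ 0])
qed simp

text \<open>The generating function is the \<open>k\<close>-th power of
  \<open>1 / (1 - s^2 X^2)\<close>; by \<open>chs_pair\<close> the coefficients obey Pascal's rule.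
  Truncated subtraction is right at \<open>k = 0\<close> too: \<open>0 choose 0\<close> is 1, and
  \<open>(e - 1) choose e\<close> is 0 for \<open>e > 0\<close>.\<close>

lemma chs_balanced:
  "chs (2 * e) (replicate_mset k s + replicate_mset k (- s)) =
     s ^ (2 * e) * real ((k + e - 1) choose e)"
proof (induction k arbitrary: e)
  case 0
  then show ?case by (cases e) simp_all
next
  case (Suc k)
  show ?case
  proof (induction e)
    case (Suc e)
    have "chs (2 * Suc e) (replicate_mset (Suc k) s + replicate_mset (Suc k) (- s)) =
      s\<^sup>2 * chs (2 * e) (replicate_mset (Suc k) s + replicate_mset (Suc k) (- s))
      + chs (2 * Suc e) (replicate_mset k s + replicate_mset k (- s))"
      using chs_pair[of "2 * e" s "replicate_mset k s + replicate_mset k (- s)"]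
      by (simp add: add_mset_commute)
    also have "\<dots> = s ^ (2 * Suc e) * (real ((k + e) choose e) + real ((k + e) choose Suc e))"
      unfolding Suc.IH Suc.prems \<open>\<And>e. chs (2 * e) (replicate_mset k s + replicate_mset k (- s)) =
         s ^ (2 * e) * real ((k + e - 1) choose e)\<close>
      by (simp add: algebra_simps power2_eq_square)
    also have "real ((k + e) choose e) + real ((k + e) choose Suc e) = real ((k + Suc e) choose Suc e)"
      by simp
    finally show ?case by simp
  qed simp
qed

section \<open>Extremal values for arguments with sum 0\<close>

text \<open>As the sum is 0, the nonnegative and the negative entries add up to \<open>s\<close> and
  \<open>- s\<close>, with \<open>s\<close> half the sum of moduli. Merging each group leaves just
  these two entries.\<close>

lemma chs_le_abs_sum:
  assumes "even d" "sum_mset M = 0"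
  shows "chs d M \<le> ((\<Sum>x\<in>#M. \<bar>x\<bar>) / 2) ^ d"
proof -
  define P where "P = filter_mset (\<lambda>x. x \<ge> 0) M"
  define N where "N = filter_mset (\<lambda>x. \<not> x \<ge> 0) M"
  define s where "s = sum_mset P"
  have M: "M = P + N" by (simp add: P_def N_def)
  have sN: "sum_mset N = - s" using assms(2) by (simp add: M s_def)
  have "(\<Sum>x\<in>#P. \<bar>x\<bar>) = (\<Sum>x\<in>#P. x)"
    by (intro arg_cong[of _ _ sum_mset] image_mset_cong) (auto simp: P_def)
  moreover have "(\<Sum>x\<in>#N. \<bar>x\<bar>) = (\<Sum>x\<in>#N. - x)"
    by (intro arg_cong[of _ _ sum_mset] image_mset_cong) (auto simp: N_def)
  moreover have "(\<Sum>x\<in>#N. - x) = - sum_mset N"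
    by (induction N) auto
  ultimately have s: "(\<Sum>x\<in>#M. \<bar>x\<bar>) / 2 = s"
    by (simp add: M sN flip: s_def)
  obtain e where e: "d = 2 * e" using assms(1) by auto
  have "chs d M = chs d (N + P)" by (simp add: M add.commute)
  also have "\<dots> \<le> chs d (add_mset s N)"
    unfolding s_def by (rule chs_merge_le[OF assms(1)]) (simp add: P_def)
  also have "\<dots> = chs d ({#s#} + N)" by simp
  also have "\<dots> \<le> chs d (add_mset (- s) {#s#})"
    unfolding sN[symmetric] by (rule chs_merge_le[OF assms(1)]) (auto simp: N_def)
  also have "\<dots> = s ^ d"
    \<comment> \<open>For \<open>k = 1\<close> the binomial coefficient is
      \<open>e choose e\<close>, which is 1.\<close>
    using chs_balanced[of e 1 s] by (simp add: e add_mset_commute)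
  finally show ?thesis unfolding s .
qed

text \<open>\<open>R\<close> holds the entries already pushed to an end of \<open>[-s, s]\<close>,
  and \<open>I\<close> the others. Each round pushes one entry of \<open>I\<close> to an end,
  keeping the sum and the size.\<close>

lemma chs_le_balanced_aux:
  assumes "even d" "s > 0" "\<And>x. x \<in># R \<Longrightarrow> \<bar>x\<bar> = s" "\<And>x. x \<in># I \<Longrightarrow> \<bar>x\<bar> \<le> s"
    and "sum_mset (R + I) = 0"
  defines "k \<equiv> size (R + I) div 2"
  shows "chs d (R + I) \<le> chs d (replicate_mset k s + replicate_mset k (- s))"
  using assms(3-5) unfolding k_def
proof (induction "size I" arbitrary: R I rule: less_induct)
  case less
  show ?case
  proof (cases "size I \<ge> 2")
    case True
    then obtain x I1 where I1: "I = add_mset x I1" 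
      by (metis not_numeral_le_zero size_empty multi_nonempty_split)
    then have "size I1 \<ge> 1" using True by simp
    then obtain y I' where I': "I = add_mset x (add_mset y I')"
      using I1 by (metis not_one_le_zero size_empty multi_nonempty_split)
    have xy: "\<bar>x\<bar> \<le> s" "\<bar>y\<bar> \<le> s" using less.prems(2) I' by auto
    \<comment> \<open>The end on the side of \<open>x + y\<close> is chosen, so that the partner
      \<open>x + y - t\<close> stays within \<open>[-s, s]\<close>.\<close>
    define t where "t = (if x + y \<ge> 0 then s else - s)"
    have "0 \<le> (t - x) * (t - y)"
      unfolding t_def using xy by (auto intro!: mult_nonneg_nonneg mult_nonpos_nonpos)
    then have "t * (x + y - t) \<le> x * y" by (simp add: algebra_simps)
    then have "chs d (add_mset x (add_mset y (R + I')))
          \<le> chs d (add_mset t (add_mset (x + y - t) (R + I')))"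
      by (intro chs_spread_le assms(1)) simp_all
    also have "\<dots> = chs d (add_mset t R + add_mset (x + y - t) I')"
      by (simp add: add_mset_commute)
    also have "\<dots> \<le> chs d (replicate_mset (size (add_mset t R + add_mset (x + y - t) I') div 2) s
         + replicate_mset (size (add_mset t R + add_mset (x + y - t) I') div 2) (- s))"
    proof (rule less.hyps)
      show "size (add_mset (x + y - t) I') < size I" by (simp add: I')
      show "\<bar>z\<bar> = s" if "z \<in># add_mset t R" for z
        using that less.prems(1) assms(2) by (auto simp: t_def split: if_splits)
      show "\<bar>z\<bar> \<le> s" if "z \<in># add_mset (x + y - t) I'" for z
        using that less.prems(2)[of z] xy by (cases "z \<in># I'") (auto simp: t_def I' split: if_splits)
      show "sum_mset (add_mset t R + add_mset (x + y - t) I') = 0"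
        using less.prems(3) by (simp add: I')
    qed
    finally show ?thesis by (simp add: I')
  next
    case False
    define a b where "a = count R s" and "b = count R (- s)"
    have R: "R = replicate_mset a s + replicate_mset b (- s)"
    proof (rule multiset_eqI)
      fix z
      have "count R z = 0" if "z \<noteq> s" "z \<noteq> - s"
        using that less.prems(1)[of z] by (auto simp: not_in_iff[symmetric])
      then show "count R z = count (replicate_mset a s + replicate_mset b (- s)) z"
        using assms(2) by (auto simp: a_def b_def)
    qed
    have "size I = 0 \<or> size I = 1" using False by linarith
    then consider "I = {#}" | z where "I = {#z#}"
      using size_1_singleton_mset by auto
    then show ?thesis
    proof cases
      case 1
      then have "(real a - real b) * s = 0"
        using less.prems(3) by (simp add: R algebra_simps)
      then have "a = b" using assms(2) by simp
      then show ?thesis by (simp add: 1 R)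
    next
      \<comment> \<open>The last entry is an integer multiple of \<open>s\<close> of modulus at most
        \<open>s\<close>: either it is 0 and drops out, or it supplies the missing \<open>s\<close>
        or \<open>- s\<close>.\<close>
      case (2 z)
      have z: "(real b - real a) * s = z" "\<bar>z\<bar> \<le> s"
        using less.prems(2,3) by (auto simp: R 2 algebra_simps)
      then have "\<bar>real b - real a\<bar> * s \<le> 1 * s"
        using assms(2) by (simp add: abs_mult flip: z(1))
      then have "\<bar>real b - real a\<bar> \<le> 1" using assms(2) by (simp only: mult_le_cancel_right_pos)
      then consider "a = b" | "b = Suc a" | "a = Suc b" by linarith
      then show ?thesis
      proof cases
        case 1
        then show ?thesis using z by (simp add: R 2)
      next
        case b: 2
        then show ?thesis using z by (simp add: R 2 add_mset_commute)
      next
        case 3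
        then show ?thesis using z by (simp add: R 2)
      qed
    qed
  qed
qed

lemma chs_le_balanced:
  assumes "even d" "sum_mset M = 0" "\<And>x. x \<in># M \<Longrightarrow> \<bar>x\<bar> \<le> s"
  shows "chs d M \<le> s ^ d * real (((size M + d) div 2 - 1) choose (d div 2))"
proof (cases "s > 0")
  case True
  obtain e where e: "d = 2 * e" using assms(1) by auto
  have "(size M + d) div 2 = size M div 2 + e" by (simp add: e)
  then show ?thesis
    using chs_le_balanced_aux[of d s "{#}" M] assms True chs_balanced[of e "size M div 2" s]
    by (simp add: e add.commute)
next
  case False
  \<comment> \<open>With \<open>s\<close> not positive, every entry that occurs is 0; for negative
    \<open>s\<close> there is none.\<close>
  then have "M = replicate_mset (size M) 0"
    using assms(3) by (intro set_mset_subset_singletonD) force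
  then have "chs d M = 0 ^ d"
    by (metis add.left_neutral chs_empty chs_zeros)
  moreover have "0 \<le> s ^ d" using assms(1) by (rule zero_le_even_power)
  ultimately show ?thesis by (cases "d = 0") (auto simp: power_0_left)
qed

text \<open>With \<open>x\<close> kept, the other entries have mean \<open>- x / (n - 1)\<close>,
  where \<open>n\<close> is the size. Averaging them yields the spectrum of the complete graph
  scaled by \<open>x / (n - 1)\<close>.\<close>

lemma chs_ge_complete:
  assumes "even d" "x \<in># M" "sum_mset M = 0"
  shows "(x / (real (size M) - 1)) ^ d *
           chs d (add_mset (real (size M) - 1) (replicate_mset (size M - 1) (- 1))) \<le> chs d M"
\<comment> \<open>Here the divisor is 0 and so is the quotient; for \<open>d > 0\<close> only
  Hunter's theorem is left to apply.\<close>
proof (cases "size M = 1")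
  case True
  then obtain y where "M = {#y#}" using size_1_singleton_mset by blast
  then show ?thesis using assms chs_nonneg[OF assms(1), of M] by (cases "d = 0") (auto simp: power_0_left)
next
  case False
  define c where "c = x / (real (size M) - 1)"
  obtain M' where M': "M = add_mset x M'" using assms(2) by (metis insert_DiffM)
  have n: "size M' > 0" using False M' by (cases M') auto
  have c: "c * (real (size M) - 1) = x" using n by (auto simp: c_def M')
  have "c ^ d * chs d (add_mset (real (size M) - 1) (replicate_mset (size M - 1) (- 1))) =
        chs d ({#x#} + replicate_mset (size M') (- c))"
    by (subst chs_scale[symmetric]) (simp add: c, simp add: M')
  also have "\<dots> \<le> chs d ({#x#} + M')"
    using assms(3) c by (intro chs_average_le assms(1)) (simp add: M' algebra_simps)
  finally show ?thesis by (simp add: c_def M')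
qed

section \<open>The defining sum over sorted index lists\<close>

lemma chs_poly_Cons:
  "chs_poly (Suc d) (x # xs) = x * chs_poly d (x # xs) + chs_poly (Suc d) xs"
proof -
  define S where "S = (\<lambda>d n. {js. length js = d \<and> sorted js \<and> set js \<subseteq> {..<n::nat}})"
  have fin: "finite (S d n)" for d n
    unfolding S_def
    by (rule finite_subset[OF _ finite_lists_length_eq[of "{..<n}" d]]) auto
  \<comment> \<open>A sorted index list either starts with 0, which is removed, or has only positive
    entries, which are shifted down by one. The two kinds give the two summands.\<close>
  have S: "S (Suc d) (Suc n) = (#) 0 ` S d (Suc n) \<union> map Suc ` S (Suc d) n" for n
  proof (intro equalityI subsetI)
    fix js assume js: "js \<in> S (Suc d) (Suc n)"
    then obtain j ks where jk: "js = j # ks" by (auto simp: S_def length_Suc_conv)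
    show "js \<in> (#) 0 ` S d (Suc n) \<union> map Suc ` S (Suc d) n"
    proof (cases j)
      case 0
      then show ?thesis using js by (auto simp: S_def jk)
    next
      case (Suc i)
      then have pos: "\<forall>k\<in>set js. k > 0" using js by (auto simp: S_def jk)
      then have eq: "js = map Suc (map (\<lambda>k. k - 1) js)" 
        by (simp add: map_idI)
      moreover have "map (\<lambda>k. k - 1) js \<in> S (Suc d) n"
        using js pos
        by (fastforce simp: S_def sorted_wrt_map intro: sorted_wrt_mono_rel[of _ "(\<le>)"])
      ultimately show ?thesis by blast
    qed
  qed (auto simp: S_def sorted_wrt_map)
  have disj: "(#) 0 ` S d (Suc n) \<inter> map Suc ` S (Suc d) n = {}" for n
    by (auto simp: S_def)
  have chs_S: "chs_poly d xs = (\<Sum>js\<in>S d (length xs). \<Prod>j\<leftarrow>js. xs ! j)" for d xs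
    by (simp add: chs_poly_def S_def)
  have "chs_poly (Suc d) (x # xs) =
     (\<Sum>js\<in>(#) 0 ` S d (Suc (length xs)). \<Prod>j\<leftarrow>js. (x # xs) ! j) +
     (\<Sum>js\<in>map Suc ` S (Suc d) (length xs). \<Prod>j\<leftarrow>js. (x # xs) ! j)"
    unfolding chs_S by (simp only: length_Cons S) (rule sum.union_disjoint; use fin disj in auto)
  also have "(\<Sum>js\<in>(#) 0 ` S d (Suc (length xs)). \<Prod>j\<leftarrow>js. (x # xs) ! j) = x * chs_poly d (x # xs)"
    by (subst sum.reindex) (auto simp: chs_S sum_distrib_left)
  also have "(\<Sum>js\<in>map Suc ` S (Suc d) (length xs). \<Prod>j\<leftarrow>js. (x # xs) ! j) = chs_poly (Suc d) xs"
    by (subst sum.reindex) (auto simp: chs_S o_def inj_on_def)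
  finally show ?thesis .
qed

lemma chs_poly_eq_chs: "chs_poly d xs = chs d (mset xs)"
proof (induction xs arbitrary: d)
  case Nil
  have "{js::nat list. length js = d \<and> sorted js \<and> js = []} = (if d = 0 then {[]} else {})"
    by auto
  then show ?case by (simp add: chs_poly_def)
next
  case (Cons x xs)
  show ?case
  proof (induction d)
    case 0
    have "{js::nat list. js = [] \<and> sorted js \<and> set js \<subseteq> {..<length (x # xs)}} = {[]}" by auto
    then show ?case by (simp add: chs_poly_def)
  next
    case (Suc d)
    then show ?case using Cons.IH by (simp add: chs_poly_Cons chs_Suc)
  qed
qed

subsection \<open>Spectra of symmetric matrices and of graphs\<close>

lemma eigenvector_row_sum:
  assumes "A \<in> carrier_mat n n" "eigenvector A v k" "i < n"
  shows "(\<Sum>j<n. A $$ (i, j) * v $ j) = k * v $ i"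
proof -
  have v: "v \<in> carrier_vec n" "A *\<^sub>v v = k \<cdot>\<^sub>v v"
    using assms by (auto simp: eigenvector_def)
  have "(A *\<^sub>v v) $ i = (k \<cdot>\<^sub>v v) $ i" by (simp add: v(2))
  then show ?thesis
    using assms v(1) by (simp add: scalar_prod_def atLeast0LessThan)
qed

lemma eigenvector_nonzero_entry:
  assumes "A \<in> carrier_mat n n" "eigenvector A v k"
  obtains i where "i < n" "v $ i \<noteq> 0"
proof -
  have "v \<in> carrier_vec n" "v \<noteq> 0\<^sub>v n"
    using assms by (auto simp: eigenvector_def)
  then show ?thesis using that by (metis carrier_vecD eq_vecI index_zero_vec(1,2))
qed

text \<open>The form \<open>S\<close> of \<open>A\<close> at \<open>v\<close> equals its own
  conjugate, and it is \<open>k\<close> times the squared length of \<open>v\<close>, which is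
  positive.\<close>

lemma hermitian_eigenvalue_real:
  fixes A :: "complex mat"
  assumes A: "A \<in> carrier_mat n n"
    and herm: "\<And>i j. i < n \<Longrightarrow> j < n \<Longrightarrow> cnj (A $$ (i, j)) = A $$ (j, i)"
    and ev: "eigenvector A v k"
  shows "k \<in> \<real>"
proof -
  define S where "S = (\<Sum>i<n. \<Sum>j<n. cnj (v $ i) * A $$ (i, j) * v $ j)"
  define N where "N = (\<Sum>i<n. (cmod (v $ i))\<^sup>2)"
  have S: "S = k * complex_of_real N"
  proof -
    have "S = (\<Sum>i<n. cnj (v $ i) * (\<Sum>j<n. A $$ (i, j) * v $ j))"
      by (simp add: S_def sum_distrib_left mult.assoc)
    also have "\<dots> = (\<Sum>i<n. cnj (v $ i) * (k * v $ i))"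
      using eigenvector_row_sum[OF A ev] by simp
    also have "\<dots> = k * (\<Sum>i<n. v $ i * cnj (v $ i))"
      by (simp add: sum_distrib_left algebra_simps)
    finally show ?thesis by (simp add: N_def complex_mult_cnj cmod_power2)
  qed
  have "cnj S = (\<Sum>i<n. \<Sum>j<n. v $ i * A $$ (j, i) * cnj (v $ j))"
    using herm by (simp add: S_def)
  also have "\<dots> = S"
    unfolding S_def by (subst sum.swap) (simp add: ac_simps)
  finally have "cnj k * complex_of_real N = k * complex_of_real N"
    by (simp add: S)
  moreover have "N \<noteq> 0"
  proof -
    obtain i where i: "i < n" "v $ i \<noteq> 0"
      using eigenvector_nonzero_entry[OF A ev] .
    have "0 < (cmod (v $ i))\<^sup>2" using i by simp
    also have "\<dots> \<le> N" unfolding N_def using i by (intro member_le_sum) auto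
    finally show ?thesis by simp
  qed
  ultimately have "cnj k = k" by simp
  then show ?thesis by (simp add: Reals_cnj_iff)
qed

text \<open>Over the complex numbers the polynomial factors and its roots are real; the
  factorization descends because the embedding of real polynomials is injective.\<close>

lemma symmetric_char_poly_splits:
  fixes A :: "real mat"
  assumes A: "A \<in> carrier_mat n n"
    and sym: "\<And>i j. i < n \<Longrightarrow> j < n \<Longrightarrow> A $$ (i, j) = A $$ (j, i)"
  obtains es where "char_poly A = (\<Prod>e\<leftarrow>es. [:- e, 1:])" "length es = n"
proof -
  interpret poly: map_poly_inj_comm_ring_hom complex_of_real ..
  define C where "C = map_mat complex_of_real A"
  have C: "C \<in> carrier_mat n n" using A by (simp add: C_def)
  obtain as where as: "char_poly C = (\<Prod>a\<leftarrow>as. [:- a, 1:])" "length as = n"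
    using char_poly_factorized[OF C] by blast
  have real: "a \<in> \<real>" if "a \<in> set as" for a
  proof -
    have "poly (char_poly C) a = 0"
      using that unfolding as(1) by (force simp: poly_prod_list)
    then obtain v where "eigenvector C v a"
      using eigenvalue_root_char_poly[OF C] by (auto simp: eigenvalue_def)
    then show ?thesis
      using A sym by (intro hermitian_eigenvalue_real[OF C]) (auto simp: C_def)
  qed
  define es where "es = map Re as"
  have as_eq: "as = map complex_of_real es"
    using real by (simp add: es_def map_idI o_def)
  have "map_poly complex_of_real (char_poly A) = (\<Prod>a\<leftarrow>as. [:- a, 1:])"
    using of_real_hom.char_poly_hom[OF A] as(1) unfolding C_def by metis
  also have "\<dots> = map_poly complex_of_real (\<Prod>e\<leftarrow>es. [:- e, 1:])"
    unfolding as_eq poly.hom_prod_list by (simp add: o_def)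
  finally have "char_poly A = (\<Prod>e\<leftarrow>es. [:- e, 1:])"
    by (rule poly.injectivity)
  moreover have "length es = n" using as by (simp add: es_def)
  ultimately show ?thesis by (rule that)
qed

section \<open>Traces and power sums of eigenvalues\<close>

definition mat_trace :: "'a :: comm_monoid_add mat \<Rightarrow> 'a" where
  "mat_trace A = (\<Sum>i<dim_row A. A $$ (i, i))"

lemma mat_trace_mult:
  assumes "A \<in> carrier_mat n n" "B \<in> carrier_mat n n"
  shows "mat_trace (A * B) = (\<Sum>i<n. \<Sum>j<n. A $$ (i, j) * B $$ (j, i))"
  using assms by (auto simp: mat_trace_def scalar_prod_def atLeast0LessThan intro!: sum.cong)

lemma mat_trace_mult_commute:
  fixes A B :: "'a :: comm_semiring_0 mat"
  assumes "A \<in> carrier_mat n n" "B \<in> carrier_mat n n"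
  shows "mat_trace (A * B) = mat_trace (B * A)"
  unfolding mat_trace_mult[OF assms] mat_trace_mult[OF assms(2,1)]
  by (subst sum.swap) (simp add: mult.commute)

lemma mat_trace_similar:
  fixes A B :: "'a :: comm_ring_1 mat"
  assumes "similar_mat_wit A B P Q"
  shows "mat_trace A = mat_trace B"
proof -
  note D = similar_mat_witD[OF refl assms]
  have "mat_trace A = mat_trace (Q * (P * B))"
    using D mat_trace_mult_commute[of "P * B" "dim_row A" Q] by (metis mult_carrier_mat)
  also have "Q * (P * B) = (Q * P) * B" using D by (metis assoc_mult_mat)
  also have "\<dots> = B" using D by (metis left_mult_one_mat)
  finally show ?thesis .
qed

lemma upper_triangular_mult_diag:
  fixes B :: "'a :: comm_semiring_0 mat"
  assumes "B \<in> carrier_mat n n" "upper_triangular B" "i < n" "j < n"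
  shows "B $$ (i, j) * B $$ (j, i) = (if i = j then (B $$ (i, i)) * (B $$ (i, i)) else 0)"
  using upper_triangularD[OF assms(2), of i j] upper_triangularD[OF assms(2), of j i] assms
  by (cases i j rule: linorder_cases) auto

lemma proots_prod_linear: "proots (\<Prod>e\<leftarrow>es. [:- e, 1:] :: 'a :: idom poly) = mset es"
proof (induction es)
  case (Cons e es)
  have "(\<Prod>e\<leftarrow>es. [:- e, 1:] :: 'a poly) \<noteq> 0" by auto
  then show ?case using Cons by (simp add: proots_mult del: mult_pCons_left)
qed simp

text \<open>Schur decomposition gives a similar upper triangular \<open>B\<close> with the
  eigenvalues on its diagonal. The traces of \<open>A\<close> and of its square can thus be read off
  from \<open>B\<close>; symmetry turns the latter into a sum of squared entries.\<close>

lemma symmetric_proots_char_poly: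
  fixes A :: "real mat"
  assumes A: "A \<in> carrier_mat n n"
    and sym: "\<And>i j. i < n \<Longrightarrow> j < n \<Longrightarrow> A $$ (i, j) = A $$ (j, i)"
  shows "size (proots (char_poly A)) = n"
    and "sum_mset (proots (char_poly A)) = (\<Sum>i<n. A $$ (i, i))"
    and "(\<Sum>x\<in>#proots (char_poly A). x\<^sup>2) = (\<Sum>i<n. \<Sum>j<n. (A $$ (i, j))\<^sup>2)"
proof -
  obtain es where es: "char_poly A = (\<Prod>e\<leftarrow>es. [:- e, 1:])" "length es = n"
    using symmetric_char_poly_splits[OF assms] by blast
  have M: "proots (char_poly A) = mset es"
    unfolding es(1) by (rule proots_prod_linear)
  show "size (proots (char_poly A)) = n" by (simp add: M es(2))
  obtain B P Q where "schur_decomposition A es = (B, P, Q)" by (metis prod_cases3)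
  then have sim: "similar_mat_wit A B P Q" and ut: "upper_triangular B" and diag: "diag_mat B = es"
    using schur_decomposition[OF A es(1)] by blast+
  have B: "B \<in> carrier_mat n n" using similar_mat_witD2[OF A sim] by simp
  have es_eq: "es = map (\<lambda>i. B $$ (i, i)) [0..<n]"
    using B diag by (auto simp: diag_mat_def)
  have "(\<Sum>i<n. A $$ (i, i)) = mat_trace B"
    using mat_trace_similar[OF sim] A by (simp add: mat_trace_def)
  also have "\<dots> = sum_list es"
    using B by (simp add: es_eq mat_trace_def interv_sum_list_conv_sum_set_nat atLeast0LessThan)
  finally show "sum_mset (proots (char_poly A)) = (\<Sum>i<n. A $$ (i, i))"
    by (simp add: M sum_mset_sum_list)
  have "similar_mat_wit (A ^\<^sub>m 2) (B ^\<^sub>m 2) P Q"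
    by (rule similar_mat_wit_pow[OF sim])
  then have "mat_trace (A * A) = mat_trace (B * B)"
    using mat_trace_similar A B by (fastforce simp: numeral_2_eq_2)
  also have "\<dots> = (\<Sum>i<n. \<Sum>j<n. if i = j then (B $$ (i, i)) * (B $$ (i, i)) else 0)"
    unfolding mat_trace_mult[OF B B]
    by (intro sum.cong refl) (simp add: upper_triangular_mult_diag[OF B ut])
  also have "\<dots> = (\<Sum>e\<leftarrow>es. e\<^sup>2)"
    by (simp add: es_eq o_def interv_sum_list_conv_sum_set_nat atLeast0LessThan power2_eq_square)
  finally show "(\<Sum>x\<in>#proots (char_poly A). x\<^sup>2) = (\<Sum>i<n. \<Sum>j<n. (A $$ (i, j))\<^sup>2)"
    using sym by (simp add: M mat_trace_mult[OF A A] power2_eq_square sum_mset_sum_list flip: mset_map)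
qed

section \<open>Spectra of graphs as multisets\<close>

abbreviation graph_spectrum :: "'a ugraph \<Rightarrow> real multiset" where
  "graph_spectrum G \<equiv> proots (char_poly (adjacency_matrix G))"

lemma mset_graph_eigenvalues: "mset (graph_eigenvalues G) = graph_spectrum G"
  by (simp add: graph_eigenvalues_def)

lemma chs_norm_eq: "chs_norm d G = root d (chs d (graph_spectrum G))"
  by (simp add: chs_norm_def chs_poly_eq_chs mset_graph_eigenvalues)

lemma mset_graph_singular_values:
  "mset (graph_singular_values G) = image_mset abs (graph_spectrum G)"
  by (simp add: graph_singular_values_def mset_graph_eigenvalues)

lemma graph_energy_eq: "graph_energy G = (\<Sum>x\<in>#graph_spectrum G. \<bar>x\<bar>)"
  by (metis graph_energy_def mset_graph_singular_values sum_mset_sum_list)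

lemma spectral_norm_eq_Max:
  assumes "graph_spectrum G \<noteq> {#}"
  shows "spectral_norm G = Max (abs ` set_mset (graph_spectrum G))"
proof -
  have set: "set (graph_singular_values G) = abs ` set_mset (graph_spectrum G)"
    using arg_cong[OF mset_graph_singular_values[of G], of set_mset] by simp
  then obtain x xs where x: "graph_singular_values G = x # xs"
    using assms by (cases "graph_singular_values G") auto
  have "sorted_wrt (\<ge>) (graph_singular_values G)"
    by (simp add: graph_singular_values_def sorted_wrt_rev)
  then have "Max (set (graph_singular_values G)) = x"
    by (intro Max_eqI) (auto simp: x)
  then show ?thesis unfolding set by (simp add: spectral_norm_def x)
qed

lemma adjacency_matrix_obtain:
  assumes "simple_graph G" "graph_order G = n"
  obtains vs where "distinct vs" "set vs = vertices G" "length vs = n"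
    "adjacency_matrix G = mat n n (\<lambda>(i, j). if {vs ! i, vs ! j} \<in> edges G then 1 else 0)"
proof -
  define vs where "vs = (SOME vs. distinct vs \<and> set vs = vertices G)"
  have "\<exists>vs. distinct vs \<and> set vs = vertices G"
    using assms(1) finite_distinct_list[of "vertices G"] by (auto simp: simple_graph_def)
  then have vs: "distinct vs \<and> set vs = vertices G"
    unfolding vs_def by (rule someI_ex)
  moreover from vs have "length vs = n"
    using assms by (metis distinct_card graph_order_def)
  ultimately show ?thesis
    using that[of vs] by (simp add: adjacency_matrix_def adj_mat_of_def vs_def[symmetric])
qed

text \<open>The pairs correspond to the ones in the adjacency matrix, whose number is the trace of
  its square.\<close>

lemma card_ordered_edges:
  assumes "simple_graph G"
  shows "card {(u, v). {u, v} \<in> edges G} = 2 * card (edges G)"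
proof -
  have fin: "finite (edges G)"
    using assms by (auto simp: simple_graph_def intro: finite_subset[of _ "Pow (vertices G)"])
  have eq: "{(u, v). {u, v} \<in> edges G} = (\<Union>e\<in>edges G. {(u, v). {u, v} = e})" by auto
  have two: "finite {(u, v). {u, v} = e} \<and> card {(u, v). {u, v} = e} = 2" if "e \<in> edges G" for e
  proof -
    have "card e = 2" using that assms by (auto simp: simple_graph_def)
    then obtain a b where ab: "e = {a, b}" "a \<noteq> b" by (meson card_2_iff)
    then have "{(u, v). {u, v} = e} = {(a, b), (b, a)}" by (auto simp: doubleton_eq_iff)
    then show ?thesis using ab by simp
  qed
  have "card {(u, v). {u, v} \<in> edges G} = (\<Sum>e\<in>edges G. card {(u, v). {u, v} = e})"
    unfolding eq by (rule card_UN_disjoint) (use fin two in auto)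
  also have "\<dots> = 2 * card (edges G)" using two by simp
  finally show ?thesis .
qed

lemma graph_spectrum_facts:
  assumes "simple_graph G" "graph_order G = n"
  shows size_graph_spectrum: "size (graph_spectrum G) = n"
    and sum_graph_spectrum: "sum_mset (graph_spectrum G) = 0"
    and sum_squares_graph_spectrum: "(\<Sum>x\<in>#graph_spectrum G. x\<^sup>2) = 2 * real (card (edges G))"
proof -
  obtain vs where vs: "distinct vs" "set vs = vertices G" "length vs = n"
    "adjacency_matrix G = mat n n (\<lambda>(i, j). if {vs ! i, vs ! j} \<in> edges G then 1 else 0)"
    using adjacency_matrix_obtain[OF assms] by blast
  have A: "adjacency_matrix G \<in> carrier_mat n n" by (simp add: vs(4))
  have sym: "adjacency_matrix G $$ (i, j) = adjacency_matrix G $$ (j, i)" if "i < n" "j < n" for i j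
    using that by (simp add: vs(4) insert_commute)
  note facts = symmetric_proots_char_poly[OF A sym]
  show "size (graph_spectrum G) = n" by (rule facts(1))
  \<comment> \<open>No loops, hence a zero diagonal and trace 0.\<close>
  have "{v} \<notin> edges G" for v using assms(1) by (auto simp: simple_graph_def)
  then show "sum_mset (graph_spectrum G) = 0" using facts(2) by (simp add: vs(4))
  define I where "I = {p \<in> {..<n} \<times> {..<n}. {vs ! fst p, vs ! snd p} \<in> edges G}"
  have "(\<Sum>x\<in>#graph_spectrum G. x\<^sup>2) = 
      (\<Sum>i<n. \<Sum>j<n. if {vs ! i, vs ! j} \<in> edges G then 1 else 0)"
    by (subst facts(3), simp, simp, intro sum.cong) (auto simp: vs(4))
  also have "\<dots> = real (card I)"
    unfolding I_def sum.cartesian_product by (simp add: case_prod_beta flip: sum.inter_filter)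
  also have "card I = card {(u, v). {u, v} \<in> edges G}"
  proof (rule bij_betw_same_card[of "\<lambda>(i, j). (vs ! i, vs ! j)"], rule bij_betwI')
    fix p q assume "p \<in> I" "q \<in> I"
    then show "((case p of (i, j) \<Rightarrow> (vs ! i, vs ! j)) = (case q of (i, j) \<Rightarrow> (vs ! i, vs ! j))) = (p = q)"
      using vs(1,3) by (auto simp: I_def nth_eq_iff_index_eq)
  next
    fix q assume q: "q \<in> {(u, v). {u, v} \<in> edges G}"
    then have "fst q \<in> set vs" "snd q \<in> set vs"
      using assms(1) vs(2) by (auto simp: simple_graph_def)
    then obtain i j where "i < n" "j < n" "vs ! i = fst q" "vs ! j = snd q"
      using vs(3) by (metis in_set_conv_nth)
    then show "\<exists>p\<in>I. q = (case p of (i, j) \<Rightarrow> (vs ! i, vs ! j))"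
      using q by (intro bexI[of _ "(i, j)"]) (auto simp: I_def)
  qed (auto simp: I_def)
  finally show "(\<Sum>x\<in>#graph_spectrum G. x\<^sup>2) = 2 * real (card (edges G))"
    using card_ordered_edges[OF assms(1)] by simp
qed

lemma graph_spectrum_eigenvector:
  assumes "simple_graph G" "graph_order G = n" "x \<in># graph_spectrum G"
  obtains v where "eigenvector (adjacency_matrix G) v x"
proof -
  obtain vs where "adjacency_matrix G = mat n n (\<lambda>(i, j). if {vs ! i, vs ! j} \<in> edges G then 1 else 0)"
    using adjacency_matrix_obtain[OF assms(1,2)] by blast
  then have A: "adjacency_matrix G \<in> carrier_mat n n" by simp
  have "char_poly (adjacency_matrix G) \<noteq> 0" using assms(3) by auto
  then have "poly (char_poly (adjacency_matrix G)) x = 0" using assms(3) by simp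
  then show ?thesis
    using that eigenvalue_root_char_poly[OF A] by (auto simp: eigenvalue_def)
qed

section \<open>Complete graphs and matchings\<close>

lemma graph_spectrum_complete_graph:
  assumes "n \<ge> 1"
  shows "graph_spectrum (complete_graph n) = add_mset (real n - 1) (replicate_mset (n - 1) (- 1))"
proof -
  let ?K = "complete_graph n"
  have K: "simple_graph ?K" "graph_order ?K = n"
    by (auto simp: simple_graph_def graph_order_def complete_graph_def)
  obtain vs where vs: "distinct vs" "set vs = vertices ?K" "length vs = n"
    "adjacency_matrix ?K = mat n n (\<lambda>(i, j). if {vs ! i, vs ! j} \<in> edges ?K then 1 else 0)"
    using adjacency_matrix_obtain[OF K] by blast
  have A: "adjacency_matrix ?K \<in> carrier_mat n n" by (simp add: vs(4))
  have entry: "adjacency_matrix ?K $$ (i, j) = (if i = j then 0 else 1)" if "i < n" "j < n" for i j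
  proof -
    have "vs ! i < n" "vs ! j < n" "vs ! i = vs ! j \<longleftrightarrow> i = j"
      using that vs nth_mem[of i vs] nth_mem[of j vs]
      by (auto simp: complete_graph_def nth_eq_iff_index_eq)
    then show ?thesis using that unfolding vs(4) by (auto simp: complete_graph_def card_insert_if)
  qed
  have roots: "x = - 1 \<or> x = real n - 1" if x: "x \<in># graph_spectrum ?K" for x
  proof -
    obtain v where v: "eigenvector (adjacency_matrix ?K) v x"
      using graph_spectrum_eigenvector[OF K x] .
    define S where "S = (\<Sum>j<n. v $ j)"
    \<comment> \<open>Row \<open>i\<close> sums all entries of \<open>v\<close> but the
      \<open>i\<close>-th. Adding up over \<open>i\<close> gives \<open>(x + 1) * S = n * S\<close>,
      so either \<open>x = n - 1\<close> or \<open>S = 0\<close>, and the latter forces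
      \<open>x = - 1\<close>.\<close>
    have row: "S = (x + 1) * v $ i" if "i < n" for i
    proof -
      have "x * v $ i = (\<Sum>j<n. v $ j - (if j = i then v $ j else 0))"
        unfolding eigenvector_row_sum[OF A v that, symmetric]
        using that by (intro sum.cong) (auto simp: entry)
      also have "\<dots> = S - v $ i" using that by (simp add: sum_subtractf S_def)
      finally show ?thesis by (simp add: algebra_simps)
    qed
    obtain i where i: "i < n" "v $ i \<noteq> 0" using eigenvector_nonzero_entry[OF A v] .
    have "(x + 1) * S = (\<Sum>j<n. (x + 1) * v $ j)" by (simp add: S_def sum_distrib_left)
    also have "\<dots> = (\<Sum>j<n. S)" by (intro sum.cong) (simp_all flip: row)
    also have "\<dots> = real n * S" by simp
    finally have "(x + 1 - real n) * S = 0" by (simp add: algebra_simps)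
    then show ?thesis using row[OF i(1)] i(2) by auto
  qed
  define M where "M = graph_spectrum ?K"
  define a b where "a = count M (real n - 1)" and "b = count M (- 1)"
  have M: "M = replicate_mset a (real n - 1) + replicate_mset b (- 1)"
  proof (rule multiset_eqI)
    fix z
    have "count M z = 0" if "z \<noteq> - 1" "z \<noteq> real n - 1"
      using that roots by (auto simp: M_def not_in_iff[symmetric])
    then show "count M z = count (replicate_mset a (real n - 1) + replicate_mset b (- 1)) z"
      using assms by (auto simp: a_def b_def)
  qed
  have "a + b = n" using size_graph_spectrum[OF K] by (simp add: M flip: M_def)
  moreover have "real a * (real n - 1) = real b"
    using sum_graph_spectrum[OF K] by (simp add: M flip: M_def)
  ultimately have "real a * real n = real n" by (simp add: algebra_simps flip: of_nat_add)
  then have "a = 1" using assms by simp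
  moreover have "b = n - 1" using \<open>a + b = n\<close> \<open>a = 1\<close> by linarith
  ultimately show ?thesis by (simp add: M flip: M_def)
qed

text \<open>For an eigenvector entry that is not 0, a vertex without neighbour forces
  \<open>x = 0\<close>, and one with a neighbour forces \<open>x^2 = 1\<close>, as the equation is
  applied at both ends of the edge. Size, sum and sum of squares fix the three
  multiplicities.\<close>

lemma graph_spectrum_matching:
  assumes "simple_graph G" "graph_order G = n" "\<forall>v\<in>vertices G. vertex_degree G v \<le> 1"
  defines "m \<equiv> card (edges G)"
  shows "graph_spectrum G = replicate_mset m 1 + replicate_mset m (- 1) + replicate_mset (n - 2 * m) 0"
proof -
  obtain vs where vs: "distinct vs" "set vs = vertices G" "length vs = n"
    "adjacency_matrix G = mat n n (\<lambda>(i, j). if {vs ! i, vs ! j} \<in> edges G then 1 else 0)"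
    using adjacency_matrix_obtain[OF assms(1,2)] by blast
  have A: "adjacency_matrix G \<in> carrier_mat n n" by (simp add: vs(4))
  have fin: "finite (edges G)"
    using assms(1) by (auto simp: simple_graph_def intro: finite_subset[of _ "Pow (vertices G)"])
  have uniq: "j = k" if ij: "i < n" "j < n" "k < n" 
    "{vs ! i, vs ! j} \<in> edges G" "{vs ! i, vs ! k} \<in> edges G" for i j k
  proof -
    have "vs ! i \<in> vertices G" using ij(1) vs(2,3) by (metis nth_mem)
    then have "card {e \<in> edges G. vs ! i \<in> e} \<le> 1"
      using assms(3) by (auto simp: vertex_degree_def)
    then have "{vs ! i, vs ! j} = {vs ! i, vs ! k}"
      using ij(4,5) fin by (simp add: card_le_Suc0_iff_eq)
    then show ?thesis using ij(1-3) vs(1,3) by (auto simp: doubleton_eq_iff nth_eq_iff_index_eq)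
  qed
  have row: "x * v $ i = v $ j" if v: "eigenvector (adjacency_matrix G) v x"
    and ij: "i < n" "j < n" "{vs ! i, vs ! j} \<in> edges G" for x v i j
  proof -
    have entry: "adjacency_matrix G $$ (i, k) * v $ k = (if k = j then v $ j else 0)" if "k < n" for k
      using uniq[OF ij(1,2) that ij(3)] ij that by (cases "k = j") (auto simp: vs(4))
    have "x * v $ i = (\<Sum>k<n. if k = j then v $ j else 0)"
      unfolding eigenvector_row_sum[OF A v ij(1), symmetric] by (intro sum.cong) (simp_all add: entry)
    then show ?thesis using ij by simp
  qed
  have roots: "x = 0 \<or> x = 1 \<or> x = - 1" if x: "x \<in># graph_spectrum G" for x
  proof -
    obtain v where v: "eigenvector (adjacency_matrix G) v x"
      using graph_spectrum_eigenvector[OF assms(1,2) x] .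
    obtain i where i: "i < n" "v $ i \<noteq> 0" using eigenvector_nonzero_entry[OF A v] .
    show ?thesis
    proof (cases "\<exists>j<n. {vs ! i, vs ! j} \<in> edges G")
      case True
      then obtain j where j: "j < n" "{vs ! i, vs ! j} \<in> edges G" by blast
      then have "x * (x * v $ i) = v $ i"
        using row[OF v i(1) j] row[OF v j(1) i(1)] by (simp add: insert_commute)
      then have "(x - 1) * (x + 1) * v $ i = 0" by (simp add: algebra_simps)
      then show ?thesis using i(2) by auto
    next
      case False
      then have "(\<Sum>j<n. adjacency_matrix G $$ (i, j) * v $ j) = 0"
        using i(1) by (intro sum.neutral) (auto simp: vs(4))
      then show ?thesis using eigenvector_row_sum[OF A v i(1)] i(2) by simp
    qed
  qed
  define M where "M = graph_spectrum G"
  define a b c where "a = count M 1" and "b = count M (- 1)" and "c = count M 0"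
  have M: "M = replicate_mset a 1 + replicate_mset b (- 1) + replicate_mset c 0"
  proof (rule multiset_eqI)
    fix z
    have "count M z = 0" if "z \<noteq> 1" "z \<noteq> - 1" "z \<noteq> 0"
      using that roots by (auto simp: M_def not_in_iff[symmetric])
    then show "count M z = count (replicate_mset a 1 + replicate_mset b (- 1) + replicate_mset c 0) z"
      by (auto simp: a_def b_def c_def)
  qed
  have "a + b + c = n" using size_graph_spectrum[OF assms(1,2)] by (simp add: M flip: M_def)
  moreover have "a = b"
    using sum_graph_spectrum[OF assms(1,2)] by (simp add: M flip: M_def)
  moreover have "real a + real b = 2 * real m"
    using sum_squares_graph_spectrum[OF assms(1,2)] by (simp add: M m_def flip: M_def)
  ultimately have "a = m" "b = m" "c = n - 2 * m" by linarith+
  then show ?thesis by (simp add: M flip: M_def)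
qed

lemma matching_exists:
  assumes "finite V" "2 * m \<le> card V"
  obtains E where "simple_graph (V, E)" "card E = m" "\<forall>v\<in>V. vertex_degree (V, E) v \<le> 1"
proof -
  obtain f where f: "bij_betw f {..<card V} V"
    using ex_bij_betw_nat_finite[OF assms(1)] by (auto simp: atLeast0LessThan)
  \<comment> \<open>Consecutive vertices of an enumeration are paired, so distinct indices give
    disjoint edges.\<close>
  define e where "e = (\<lambda>i. {f (2 * i), f (2 * i + 1)})"
  have inj: "f i = f j \<longleftrightarrow> i = j" if "i < card V" "j < card V" for i j
    using f that by (auto simp: bij_betw_def inj_on_def)
  have mem: "f i \<in> V" if "i < card V" for i using f that by (auto simp: bij_betw_def)
  have bound: "2 * i < card V \<and> 2 * i + 1 < card V" if "i < m" for i using that assms(2) by linarith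
  have disj: "i = j" if "i < m" "j < m" "v \<in> e i" "v \<in> e j" for i j v
    using that bound[of i] bound[of j] by (auto simp: e_def inj; presburger)
  have "inj_on e {..<m}"
    using disj by (auto simp: inj_on_def e_def)
  then have "card (e ` {..<m}) = m" by (simp add: card_image)
  moreover have "simple_graph (V, e ` {..<m})"
    using bound assms(1) by (auto simp: simple_graph_def e_def mem inj card_insert_if)
  moreover have "vertex_degree (V, e ` {..<m}) v \<le> 1" for v
    unfolding vertex_degree_def using disj by (auto simp: card_le_Suc0_iff_eq)
  ultimately show ?thesis using that by blast
qed

subsection \<open>Norms of graphs\<close>

lemma root_le_mult:
  assumes "d > 0" "x \<le> c ^ d * y" "c \<ge> 0"
  shows "root d x \<le> c * root d y"
proof -
  have "root d x \<le> root d (c ^ d * y)" using assms by (simp add: real_root_le_mono)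
  also have "\<dots> = c * root d y" using assms by (simp add: real_root_mult real_root_power_cancel)
  finally show ?thesis .
qed

lemma mult_root_le:
  assumes "d > 0" "c ^ d * y \<le> x" "c \<ge> 0"
  shows "c * root d y \<le> root d x"
proof -
  have "c * root d y = root d (c ^ d * y)"
    using assms by (simp add: real_root_mult real_root_power_cancel)
  also have "\<dots> \<le> root d x" using assms by (simp add: real_root_le_mono)
  finally show ?thesis .
qed

lemma chs_norm_matching:
  assumes "simple_graph H" "graph_order H = n" "\<forall>v\<in>vertices H. vertex_degree H v \<le> 1" "even d"
  shows "chs_norm d H = root d (real ((card (edges H) + d div 2 - 1) choose (d div 2)))"
proof -
  obtain e where "d = 2 * e" using assms(4) by auto
  then show ?thesis
    using graph_spectrum_matching[OF assms(1-3)] chs_balanced[of e "card (edges H)" 1]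
    by (simp add: chs_norm_eq)
qed

lemma chs_norm_le_energy:
  assumes "even d" "d > 0" "simple_graph G"
  shows "chs_norm d G \<le> 1 / 2 * graph_energy G"
proof -
  have "graph_energy G \<ge> (\<Sum>x\<in>#graph_spectrum G. 0)"
    unfolding graph_energy_eq by (rule sum_mset_mono) simp
  moreover have "chs_norm d G \<le> root d ((graph_energy G / 2) ^ d)"
    unfolding chs_norm_eq graph_energy_eq
    using assms sum_graph_spectrum[OF assms(3) refl] by (simp add: real_root_le_mono chs_le_abs_sum)
  ultimately show ?thesis using assms by (simp add: real_root_power_cancel)
qed

text \<open>A single edge is a matching, with spectrum 1, -1 and zeros: the norm is 1 and the energy
  2.\<close>

lemma chs_norm_one_edge:
  assumes "simple_graph H" "card (edges H) = 1" "even d" "d > 0"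
  shows "chs_norm d H = 1 / 2 * graph_energy H"
proof -
  have deg: "vertex_degree H v \<le> 1" for v
  proof -
    have "card {e \<in> edges H. v \<in> e} \<le> card (edges H)"
      using assms(2) by (intro card_mono) (auto intro: card_ge_0_finite)
    then show ?thesis by (simp add: vertex_degree_def assms(2))
  qed
  have "chs_norm d H = 1"
    using chs_norm_matching[OF assms(1) refl _ assms(3)] deg assms by simp
  moreover have "graph_energy H = 2"
    using graph_spectrum_matching[OF assms(1) refl] deg assms(2) by (simp add: graph_energy_eq)
  ultimately show ?thesis by simp
qed

lemma spectral_norm_complete_graph:
  assumes "n \<ge> 2"
  shows "spectral_norm (complete_graph n) = real n - 1"
proof -
  have "abs ` set_mset (graph_spectrum (complete_graph n)) = {real n - 1, 1}"
    using assms by (subst graph_spectrum_complete_graph) auto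
  then show ?thesis
    using assms spectral_norm_eq_Max[of "complete_graph n"] graph_spectrum_complete_graph[of n]
    by (simp add: max_def)
qed

lemma spectral_norm_matching:
  assumes "simple_graph H" "\<forall>v\<in>vertices H. vertex_degree H v \<le> 1" "card (edges H) > 0"
  shows "spectral_norm H = 1"
proof -
  note M = graph_spectrum_matching[OF assms(1) refl assms(2)]
  have "graph_spectrum H \<noteq> {#}" using assms(3) by (simp add: M)
  moreover have "Max (abs ` set_mset (graph_spectrum H)) = 1"
    using assms(3) by (intro Max_eqI) (auto simp: M split: if_splits)
  ultimately show ?thesis by (simp add: spectral_norm_eq_Max)
qed

theorem theorem1p11:
  fixes G :: "'a ugraph" and n d :: nat
  assumes "even d" and "d \<ge> 2"
    and "simple_graph G" and "graph_order G = n" and "n \<ge> 2"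
  shows
    "(chs_norm d G \<le> 1 / 2 * graph_energy G \<and>
      (\<exists>H :: 'a ugraph. simple_graph H \<and> graph_order H = n \<and> card (edges H) = 1) \<and>
      (\<forall>H :: 'a ugraph. simple_graph H \<and> graph_order H = n \<and> card (edges H) = 1 \<longrightarrow>
         chs_norm d H = 1 / 2 * graph_energy H)) \<and>
     (chs_norm d (complete_graph n) / (real n - 1) * spectral_norm G \<le> chs_norm d G \<and>
      chs_norm d G \<le> root d (real (((n + d) div 2 - 1) choose (d div 2))) * spectral_norm G \<and>
      chs_norm d (complete_graph n) / (real n - 1) * spectral_norm (complete_graph n)
        = chs_norm d (complete_graph n) \<and>
      (\<exists>H :: 'a ugraph. simple_graph H \<and> graph_order H = n \<and> card (edges H) = n div 2 \<and>
         (\<forall>v\<in>vertices H. vertex_degree H v \<le> 1)) \<and>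
      (\<forall>H :: 'a ugraph. simple_graph H \<and> graph_order H = n \<and> card (edges H) = n div 2 \<and>
         (\<forall>v\<in>vertices H. vertex_degree H v \<le> 1) \<longrightarrow>
         chs_norm d H
           = root d (real (((n + d) div 2 - 1) choose (d div 2))) * spectral_norm H))"
proof -
  have d: "d > 0" using assms(2) by simp
  let ?M = "graph_spectrum G" and ?K = "complete_graph n"
  have size: "size ?M = n" and sum: "sum_mset ?M = 0"
    using assms(3,4) by (simp_all add: size_graph_spectrum sum_graph_spectrum)
  have fin: "finite (vertices G)" and card: "card (vertices G) = n"
    using assms(3,4) by (simp_all add: simple_graph_def graph_order_def)
  have ne: "?M \<noteq> {#}" using size assms(5) by auto
  have norm: "spectral_norm G = Max (abs ` set_mset ?M)" by (rule spectral_norm_eq_Max[OF ne])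
  have le: "\<bar>x\<bar> \<le> spectral_norm G" if "x \<in># ?M" for x
    unfolding norm using that by (intro Max_ge) auto
  have "spectral_norm G \<in> abs ` set_mset ?M"
    unfolding norm using ne by (intro Max_in) auto
  \<comment> \<open>An eigenvalue of largest modulus, of unknown sign; the even power in
    \<open>chs_ge_complete\<close> hides the sign.\<close>
  then obtain x where x: "x \<in># ?M" "spectral_norm G = \<bar>x\<bar>" by auto
  have lower: "chs_norm d ?K / (real n - 1) * spectral_norm G \<le> chs_norm d G"
  proof -
    have "(spectral_norm G / (real n - 1)) ^ d * chs d (graph_spectrum ?K) \<le> chs d ?M"
      using chs_ge_complete[OF assms(1) x(1) sum] graph_spectrum_complete_graph[of n] assms(1,5) size x(2)
      by (simp add: power_divide power_even_abs)
    then have "spectral_norm G / (real n - 1) * chs_norm d ?K \<le> chs_norm d G"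
      unfolding chs_norm_eq using d assms(5) x(2) by (intro mult_root_le) auto
    then show ?thesis by (simp add: mult.commute)
  qed
  have upper: "chs_norm d G \<le> root d (real (((n + d) div 2 - 1) choose (d div 2))) * spectral_norm G"
    unfolding chs_norm_eq mult.commute[of _ "spectral_norm G"]
    using chs_le_balanced[OF assms(1) sum le] size x(2) d by (intro root_le_mult) auto
  \<comment> \<open>As \<open>d\<close> is even, \<open>d div 2\<close> can be taken into the floor;
    this matches the value for \<open>n div 2\<close> edges with the constant of the upper
    bound.\<close>
  have half: "n div 2 + d div 2 = (n + d) div 2" using assms(1) by auto
  \<comment> \<open>Both existence claims are cases of this one, with \<open>m = 1\<close> and
    \<open>m = n div 2\<close>. The vertex set of \<open>G\<close> is reused, which ensures
    \<open>n\<close> vertices of type \<open>'a\<close>.\<close>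
  have ex1: "\<exists>H :: 'a ugraph. simple_graph H \<and> graph_order H = n \<and> card (edges H) = m \<and>
         (\<forall>v\<in>vertices H. vertex_degree H v \<le> 1)" if m: "2 * m \<le> n" for m
  proof -
    obtain E where "simple_graph (vertices G, E)" "card E = m"
      "\<forall>v\<in>vertices G. vertex_degree (vertices G, E) v \<le> 1"
      using matching_exists[OF fin, of m] m card by auto
    then show ?thesis
      using card by (intro exI[of _ "(vertices G, E)"]) (simp add: graph_order_def)
  qed
  have max: "chs_norm d H = root d (real (((n + d) div 2 - 1) choose (d div 2))) * spectral_norm H"
    if H: "simple_graph H" "graph_order H = n" "card (edges H) = n div 2"
      "\<forall>v\<in>vertices H. vertex_degree H v \<le> 1" for H :: "'a ugraph"
    using chs_norm_matching[OF H(1,2,4) assms(1)] spectral_norm_matching[OF H(1,4)] H(3) assms(5)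
    by (simp add: half)
  have K: "chs_norm d ?K / (real n - 1) * spectral_norm ?K = chs_norm d ?K"
    using assms(5) by (simp add: spectral_norm_complete_graph)
  have ex2: "\<exists>H :: 'a ugraph. simple_graph H \<and> graph_order H = n \<and> card (edges H) = 1"
    using ex1[of 1] assms(5) by auto
  have ex3: "\<exists>H :: 'a ugraph. simple_graph H \<and> graph_order H = n \<and> card (edges H) = n div 2 \<and>
         (\<forall>v\<in>vertices H. vertex_degree H v \<le> 1)"
    by (rule ex1) simp
  show ?thesis
    using chs_norm_le_energy[OF assms(1) d assms(3)] ex2 chs_norm_one_edge[OF _ _ assms(1) d]
      lower upper K ex3 max by blast
qed

end
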